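(* For $n\geq 1$, \begin{equation*} \sum_{\pi\in\mathrm{PPF}_n}F_{n,\mathrm{Tie}(\pi)} =\sum_{i=1}^n (n-2)^{i-1}s_{(i,1^{n-i})}. \end{equation*}
   Context: A parking function of length $n$ is a sequence of positive integers whose increasing rearrangement $\lambda$ satisfies $\lambda_i\le i$; it is prime if removing any instance of 1 yields a parking function of length $n-1$. $\mathrm{PPF}_n$ denotes the set of prime parking functions of length $n$. $\mathrm{Tie}(\pi)=\{i\in[n-1]:\pi_i=\pi_{i+1}\}$. For $S\subseteq[n-1]$, $F_{n,S}=\sum_{1\le b_1\le\cdots\le b_n,\ i\in S\Rightarrow b_i<b_{i+1}} x_{b_1}\cdots x_{b_n}$ is Gessel's fundamental quasisymmetric function, and $s_{(i,1^{n-i})}$ is the Schur function of the hook partition $(i,1^{n-i})$. *)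

theory Defs
  imports Complex_Main "HOL-Library.Multiset"
begin

definition parking_function :: "nat list \<Rightarrow> bool" where
  "parking_function \<pi> \<longleftrightarrow>
     (\<forall>a\<in>set \<pi>. 1 \<le> a) \<and> (\<forall>i<length \<pi>. sort \<pi> ! i \<le> i + 1)"

definition prime_parking_function :: "nat list \<Rightarrow> bool" where
  "prime_parking_function \<pi> \<longleftrightarrow>
     parking_function \<pi> \<and>
     (\<forall>i<length \<pi>. \<pi> ! i = 1 \<longrightarrow> parking_function (take i \<pi> @ drop (Suc i) \<pi>))"

definition PPF :: "nat \<Rightarrow> nat list set" where
  "PPF n = {\<pi>. length \<pi> = n \<and> prime_parking_function \<pi>}"

text \<open>Positions in sequences are counted from 1, so \<open>\<pi>\<^sub>i\<close> is \<open>\<pi> ! (i - 1)\<close>.\<close>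

definition Tie :: "nat list \<Rightarrow> nat set" where
  "Tie \<pi> = {i \<in> {1..length \<pi> - 1}. \<pi> ! (i - 1) = \<pi> ! i}"

lemma finite_PPF: "finite (PPF n)"
proof (rule finite_subset)
  show "PPF n \<subseteq> {\<pi>. set \<pi> \<subseteq> {..n} \<and> length \<pi> = n}"
  proof (intro subsetI CollectI conjI)
    fix \<pi> a
    assume \<pi>: "\<pi> \<in> PPF n" and "a \<in> set \<pi>"
    then have "a \<in> set (sort \<pi>)" by simp
    then obtain i where "i < length \<pi>" "sort \<pi> ! i = a"
      by (metis in_set_conv_nth length_sort)
    with \<pi> show "a \<in> {..n}"
      by (auto simp: PPF_def prime_parking_function_def parking_function_def
               dest!: spec[of _ i])
  qed (auto simp: PPF_def)
qed (simp add: finite_lists_length_eq)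

text \<open>
  Formal power series in \<open>x\<^sub>1, x\<^sub>2, \<dots>\<close> with coefficients in \<open>'a\<close>. The monomial
  \<open>x\<^bsub>b\<^sub>1\<^esub> \<cdots> x\<^bsub>b\<^sub>n\<^esub>\<close> is the multiset \<open>{#b\<^sub>1, \<dots>, b\<^sub>n#}\<close> of its variable indices.
\<close>

typedef 'a pser = "UNIV :: (nat multiset \<Rightarrow> 'a) set"
  morphisms pser_coeff Abs_pser
  by simp

setup_lifting type_definition_pser

lemma pser_eq_iff: "f = g \<longleftrightarrow> (\<forall>m. pser_coeff f m = pser_coeff g m)"
  by transfer auto

instantiation pser :: (ab_group_add) ab_group_add
begin

lift_definition zero_pser :: "'a pser" is "\<lambda>m. 0" .
lift_definition plus_pser :: "'a pser \<Rightarrow> 'a pser \<Rightarrow> 'a pser" is "\<lambda>f g m. f m + g m" .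
lift_definition minus_pser :: "'a pser \<Rightarrow> 'a pser \<Rightarrow> 'a pser" is "\<lambda>f g m. f m - g m" .
lift_definition uminus_pser :: "'a pser \<Rightarrow> 'a pser" is "\<lambda>f m. - f m" .

instance
  by (standard; transfer; simp add: fun_eq_iff algebra_simps)

end

lift_definition pser_smult :: "'a::times \<Rightarrow> 'a pser \<Rightarrow> 'a pser" (infixr "\<cdot>\<^sub>p" 75)
  is "\<lambda>c f m. c * f m" .

text \<open>
  The sum of the monomials \<open>w t\<close> for \<open>t \<in> A\<close>. It is meaningful only if every monomial
  arises from finitely many \<open>t\<close>, which is shown below for each use.
\<close>

lift_definition monomial_sum :: "'i set \<Rightarrow> ('i \<Rightarrow> nat multiset) \<Rightarrow> int pser"
  is "\<lambda>A w m. int (card {t \<in> A. w t = m})" .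

definition fundamental_seqs :: "nat \<Rightarrow> nat set \<Rightarrow> nat list set" where
  "fundamental_seqs n S =
     {b. length b = n \<and> (\<forall>a\<in>set b. 1 \<le> a) \<and> sorted b \<and>
         (\<forall>i\<in>{1..<n}. i \<in> S \<longrightarrow> b ! (i - 1) < b ! i)}"

definition fundamental_qsym :: "nat \<Rightarrow> nat set \<Rightarrow> int pser" where
  "fundamental_qsym n S = monomial_sum (fundamental_seqs n S) mset"

text \<open>
  A tableau of shape \<open>\<lambda>\<close> (a weakly decreasing list of positive integers) is the list of
  its rows, in English notation.
\<close>

definition ssyt :: "nat list \<Rightarrow> nat list list set" where
  "ssyt shape =
     {T. map length T = shape \<and>
         (\<forall>r\<in>set T. sorted r \<and> (\<forall>a\<in>set r. 1 \<le> a)) \<and>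
         (\<forall>i j. Suc i < length T \<longrightarrow> j < length (T ! Suc i) \<longrightarrow> T ! i ! j < T ! Suc i ! j)}"

definition schur :: "nat list \<Rightarrow> int pser" where
  "schur shape = monomial_sum (ssyt shape) (\<lambda>T. mset (concat T))"

definition hook :: "nat \<Rightarrow> nat \<Rightarrow> nat list" where
  "hook n i = i # replicate (n - i) 1"

lemma finite_fundamental_fibre: "finite {b \<in> fundamental_seqs n S. mset b = m}"
proof (rule finite_subset)
  show "{b \<in> fundamental_seqs n S. mset b = m} \<subseteq> {b. set b \<subseteq> set_mset m \<and> length b = n}"
    by (auto simp: fundamental_seqs_def)
qed (simp add: finite_lists_length_eq)

lemma finite_ssyt_fibre: "finite {T \<in> ssyt shape. mset (concat T) = m}"
proof (rule finite_subset)
  let ?R = "{r. set r \<subseteq> set_mset m \<and> length r \<le> sum_list shape}"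
  show "{T \<in> ssyt shape. mset (concat T) = m} \<subseteq> {T. set T \<subseteq> ?R \<and> length T = length shape}"
    by (force simp: ssyt_def intro!: member_le_sum_list)
qed (simp add: finite_lists_length_eq finite_lists_length_le)

end

theory Submission
  imports Defs
begin

text \<open>
  Compare the coefficients of a monomial of degree \<open>n\<close> with \<open>k\<close> distinct variables. On the right,
  a hook tableau of shape \<open>(i, 1\<^bsup>n-i\<^esup>)\<close> with this content is given by choosing the \<open>n - i\<close> entries
  below the corner among the \<open>k - 1\<close> non-minimal variables, so the coefficient is
  \<open>\<Sum>\<^sub>i (n-2)\<^bsup>i-1\<^esup> \<cdot> (k-1 choose n-i) = (n-2)\<^bsup>n-k\<^esup> (n-1)\<^bsup>k-1\<^esup>\<close>. On the left, it is the number of prime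
  parking functions without ties at \<open>n - k\<close> prescribed positions. By the cycle lemma, every sequence
  in \<open>(\<int>/(n-1))\<^sup>n\<close> has exactly one translate by a constant that is a prime parking function.
  Translation preserves ties, so this number is \<open>1/(n-1)\<close> times the number
  \<open>(n-1) (n-2)\<^bsup>n-k\<^esup> (n-1)\<^bsup>k-1\<^esup>\<close> of all sequences without these ties.
\<close>

section \<open>Prime parking functions through counting\<close>

text \<open>In a sorted list the entries at most \<open>v\<close> form an initial segment, whose
  length decides which indices lie in it.\<close>

lemma sorted_nth_le_iff:
  fixes xs :: "'a::linorder list"
  assumes "sorted xs" "i < length xs"
  shows "xs ! i \<le> v \<longleftrightarrow> i < length (filter (\<lambda>x. x \<le> v) xs)"
  using assms
proof (induction xs arbitrary: i)
  case (Cons x xs)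
  show ?case
  proof (cases "x \<le> v")
    case True
    with Cons show ?thesis by (cases i) auto
  next
    case False
    with Cons.prems have "filter (\<lambda>x. x \<le> v) (x # xs) = []"
      by (auto simp: filter_empty_conv)
    moreover have "x \<le> (x # xs) ! i"
      using Cons.prems by (cases i) auto
    ultimately show ?thesis using False by auto
  qed
qed simp

text \<open>Counting replaces sorting here: the counts ignore the order of the entries and can be
  followed through deletions and rotations. The 0-based index \<open>i\<close> becomes the value
  \<open>v = i + 1\<close>.\<close>

lemma parking_function_iff:
  "parking_function \<pi> \<longleftrightarrow>
     (\<forall>a\<in>set \<pi>. 1 \<le> a) \<and> (\<forall>v\<in>{1..length \<pi>}. v \<le> length (filter (\<lambda>x. x \<le> v) \<pi>))"
proof -
  have "(\<forall>i<length \<pi>. sort \<pi> ! i \<le> i + 1) \<longleftrightarrow>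
        (\<forall>i<length \<pi>. Suc i \<le> length (filter (\<lambda>x. x \<le> Suc i) \<pi>))"
    by (simp add: sorted_nth_le_iff filter_sort Suc_le_eq)
  also have "\<dots> \<longleftrightarrow> (\<forall>v\<in>{1..length \<pi>}. v \<le> length (filter (\<lambda>x. x \<le> v) \<pi>))"
  proof (intro iffI ballI allI impI)
    fix v assume "\<forall>i<length \<pi>. Suc i \<le> length (filter (\<lambda>x. x \<le> Suc i) \<pi>)" "v \<in> {1..length \<pi>}"
    then show "v \<le> length (filter (\<lambda>x. x \<le> v) \<pi>)" by (cases v) auto
  next
    fix i assume "\<forall>v\<in>{1..length \<pi>}. v \<le> length (filter (\<lambda>x. x \<le> v) \<pi>)" "i < length \<pi>"
    then show "Suc i \<le> length (filter (\<lambda>x. x \<le> Suc i) \<pi>)"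
      by (elim bspec) auto
  qed
  finally show ?thesis
    unfolding parking_function_def by blast
qed

text \<open>Deleting a 1 lowers each count with \<open>v \<ge> 1\<close> by exactly one, which turns
  the weak inequalities for the shorter list into strict ones for \<open>\<pi>\<close>.\<close>

lemma parking_function_remove_one_iff:
  assumes pos: "\<forall>a\<in>set \<pi>. 1 \<le> a" and i: "i < length \<pi>" "\<pi> ! i = 1"
  shows "parking_function (take i \<pi> @ drop (Suc i) \<pi>) \<longleftrightarrow>
         (\<forall>v\<in>{1..length \<pi> - 1}. v < length (filter (\<lambda>x. x \<le> v) \<pi>))"
proof -
  let ?\<rho> = "take i \<pi> @ drop (Suc i) \<pi>"
  have split: "\<pi> = take i \<pi> @ 1 # drop (Suc i) \<pi>"
    using i id_take_nth_drop by metis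
  have "length (filter (\<lambda>x. x \<le> v) \<pi>) = Suc (length (filter (\<lambda>x. x \<le> v) ?\<rho>))" if "1 \<le> v" for v
    using that by (subst split) simp
  moreover have "length ?\<rho> = length \<pi> - 1"
    using i by auto
  moreover have "\<forall>a\<in>set ?\<rho>. 1 \<le> a"
    using pos by (auto dest: in_set_takeD in_set_dropD)
  ultimately show ?thesis
    unfolding parking_function_iff by (auto simp: less_Suc_eq_le)
qed

text \<open>Strict counting inequalities absorb both the parking condition and all deletions. For
  \<open>n = 1\<close> their range is empty and every \<open>[a]\<close> with
  \<open>a \<ge> 1\<close> would pass, hence the bound on \<open>n\<close>.\<close>

lemma PPF_iff:
  assumes "2 \<le> n"
  shows "\<pi> \<in> PPF n \<longleftrightarrow> length \<pi> = n \<and> (\<forall>a\<in>set \<pi>. 1 \<le> a) \<and>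
           (\<forall>v\<in>{1..n - 1}. v < length (filter (\<lambda>x. x \<le> v) \<pi>))"
proof
  assume L: "\<pi> \<in> PPF n"
  then have len: "length \<pi> = n" and pf: "parking_function \<pi>"
    by (auto simp: PPF_def prime_parking_function_def)
  from pf have pos: "\<forall>a\<in>set \<pi>. 1 \<le> a"
    by (simp add: parking_function_def)
  \<comment> \<open>The inequality at \<open>v = 1\<close> supplies an actual 1, so that the
    deletion condition is not vacuous.\<close>
  from pf len assms have "1 \<le> length (filter (\<lambda>x. x \<le> 1) \<pi>)"
    unfolding parking_function_iff by auto
  then have "filter (\<lambda>x. x \<le> 1) \<pi> \<noteq> []" by auto
  then obtain a where "a \<in> set \<pi>" "a \<le> 1"
    by (auto simp: filter_empty_conv)
  with pos have "1 \<in> set \<pi>"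
    by (metis le_antisym)
  then obtain i where i: "i < length \<pi>" "\<pi> ! i = 1"
    by (auto simp: in_set_conv_nth)
  with L have "parking_function (take i \<pi> @ drop (Suc i) \<pi>)"
    by (auto simp: PPF_def prime_parking_function_def)
  then show "length \<pi> = n \<and> (\<forall>a\<in>set \<pi>. 1 \<le> a) \<and>
           (\<forall>v\<in>{1..n - 1}. v < length (filter (\<lambda>x. x \<le> v) \<pi>))"
    using parking_function_remove_one_iff[OF pos i] len pos by simp
next
  assume R: "length \<pi> = n \<and> (\<forall>a\<in>set \<pi>. 1 \<le> a) \<and>
           (\<forall>v\<in>{1..n - 1}. v < length (filter (\<lambda>x. x \<le> v) \<pi>))"
  \<comment> \<open>The case \<open>v = n - 1\<close> forces all \<open>n\<close> entries below
    \<open>n\<close>; this yields the remaining parking inequality at \<open>v = n\<close>.\<close>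
  have "n - 1 < length (filter (\<lambda>x. x \<le> n - 1) \<pi>)"
    using R assms by auto
  then have "\<not> length (filter (\<lambda>x. x \<le> n - 1) \<pi>) < length \<pi>"
    using R by linarith
  then have "\<forall>a\<in>set \<pi>. a \<le> n - 1"
    by (meson length_filter_less)
  then have "filter (\<lambda>x. x \<le> n) \<pi> = \<pi>"
    by (intro filter_True) auto
  then have "v \<le> length (filter (\<lambda>x. x \<le> v) \<pi>)" if "v \<in> {1..n}" for v
    using that R by (cases "v = n") (auto simp: less_imp_le)
  then have "parking_function \<pi>"
    using R by (auto simp: parking_function_iff)
  then show "\<pi> \<in> PPF n"
    using R parking_function_remove_one_iff[of \<pi>]
    by (auto simp: PPF_def prime_parking_function_def)
qed

text \<open>The entries thus form representatives of residues modulo \<open>n - 1\<close>, which is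
  the modulus for the cycle lemma.\<close>

lemma PPF_set_subset:
  assumes "2 \<le> n" "\<pi> \<in> PPF n"
  shows "set \<pi> \<subseteq> {1..n - 1}"
proof -
  have "n - 1 < length (filter (\<lambda>x. x \<le> n - 1) \<pi>)" and len: "length \<pi> = n"
    and pos: "\<forall>a\<in>set \<pi>. 1 \<le> a"
    using assms PPF_iff[OF assms(1), of \<pi>] by auto
  then have "\<not> length (filter (\<lambda>x. x \<le> n - 1) \<pi>) < length \<pi>" by linarith
  with pos show ?thesis
    by (metis (no_types, lifting) atLeastAtMost_iff length_filter_less subsetI)
qed

section \<open>The cycle lemma\<close>

text \<open>The good starting point is the last position in a period at which \<open>S\<close> is minimal.\<close>

lemma cycle_lemma:
  fixes S :: "nat \<Rightarrow> int"
  assumes per: "\<And>j. S (j + N) = S j + 1" and "0 < N"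
  shows "\<exists>!r. r < N \<and> (\<forall>i\<in>{1..N}. S r < S (r + i))"
proof -
  define M where "M = Min (S ` {..<N})"
  have M_le: "M \<le> S j" if "j < N" for j
    using that by (simp add: M_def)
  have "M \<in> S ` {..<N}"
    unfolding M_def using \<open>0 < N\<close> by (intro Min_in) auto
  then have ne: "{j. j < N \<and> S j = M} \<noteq> {}" by auto
  define r where "r = Max {j. j < N \<and> S j = M}"
  have r: "r < N" "S r = M"
    using Max_in[OF _ ne] by (auto simp: r_def)
  have last: "j \<le> r" if "j < N" "S j = M" for j
    using that by (auto simp: r_def)
  have good: "S r < S (r + i)" if "i \<in> {1..N}" for i
  proof (cases "r + i < N")
    case True
    with M_le[OF True] last[OF True] r that show ?thesis by (auto simp: order_less_le)
  next
    \<comment> \<open>Past the end of the period, the gain of 1 makes even a return to the minimum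
      strictly larger than \<open>M\<close>.\<close>
    case False
    then have "S (r + i) = S (r + i - N) + 1"
      using per[of "r + i - N"] by simp
    moreover have "M \<le> S (r + i - N)"
      using False r that by (intro M_le) auto
    ultimately show ?thesis using r by simp
  qed
  \<comment> \<open>Two good starts \<open>r < r'\<close> would give
    \<open>S r < S r' < S (r + N) = S r + 1\<close>, impossible for integers.\<close>
  have not_less: "\<not> r < r'"
    if "r < N" "\<forall>i\<in>{1..N}. S r < S (r + i)" "r' < N" "\<forall>i\<in>{1..N}. S r' < S (r' + i)" for r r'
  proof
    assume "r < r'"
    have "S r < S (r + (r' - r))"
      by (rule bspec[OF that(2)]) (use \<open>r < r'\<close> that in auto)
    moreover have "S r' < S (r' + (r + N - r'))"
      by (rule bspec[OF that(4)]) (use \<open>r < r'\<close> that in auto)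
    ultimately show False
      using per[of r] \<open>r < r'\<close> \<open>r' < N\<close> by simp
  qed
  show ?thesis
  proof (rule ex1I[of _ r])
    fix s assume "s < N \<and> (\<forall>i\<in>{1..N}. S s < S (s + i))"
    then have "\<not> r < s" "\<not> s < r"
      using not_less[of r s] not_less[of s r] r(1) good by blast+
    then show "s = r" by simp
  qed (use r(1) good in blast)
qed

section \<open>Rotations modulo \<open>N\<close> and the unique prime translate\<close>

text \<open>Translation by \<open>-r\<close> on residues, followed by the shift from
  \<open>{0..N-1}\<close> to \<open>{1..N}\<close>. Adding \<open>N\<close> first keeps the natural
  subtraction from truncating when \<open>r \<le> N\<close>.\<close>

definition rotate_to_one_based :: "nat \<Rightarrow> nat \<Rightarrow> nat list \<Rightarrow> nat list" where
  "rotate_to_one_based N r f = map (\<lambda>y. (y + N - r) mod N + 1) f"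

definition rotate_to_zero_based :: "nat \<Rightarrow> nat \<Rightarrow> nat list \<Rightarrow> nat list" where
  "rotate_to_zero_based N r \<pi> = map (\<lambda>x. (x - 1 + r) mod N) \<pi>"

lemma add_mod_eq_iff:
  fixes r t y N :: nat
  assumes "r < N" "t < N" "y < N"
  shows "y = (r + t) mod N \<longleftrightarrow> t = (y + N - r) mod N"
proof -
  have "(r + t) mod N = (if r + t < N then r + t else r + t - N)"
    using assms by (auto simp: le_mod_geq)
  moreover have "(y + N - r) mod N = (if y < r then y + N - r else y - r)"
  proof (cases "y < r")
    case False
    then have "y + N - r = (y - r) + N" using assms by simp
    then have "(y + N - r) mod N = (y - r) mod N" by (metis mod_add_self2)
    then show ?thesis using False assms by simp
  qed (use assms in simp)
  ultimately show ?thesis using assms by auto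
qed

lemma rotate_to_zero_to_one_based:
  assumes "set \<pi> \<subseteq> {1..N}" "r < N"
  shows "rotate_to_one_based N r (rotate_to_zero_based N r \<pi>) = \<pi>"
proof -
  have "((x - 1 + r) mod N + N - r) mod N + 1 = x" if "x \<in> set \<pi>" for x
    using that assms add_mod_eq_iff[of r N "x - 1" "(x - 1 + r) mod N"]
    by (fastforce simp: add.commute)
  then show ?thesis
    by (simp add: rotate_to_one_based_def rotate_to_zero_based_def map_idI)
qed

lemma rotate_to_one_to_zero_based:
  assumes "set f \<subseteq> {..<N}" "r < N"
  shows "rotate_to_zero_based N r (rotate_to_one_based N r f) = f"
proof -
  have "((y + N - r) mod N + 1 - 1 + r) mod N = y" if "y \<in> set f" for y
    using that assms add_mod_eq_iff[of r N "(y + N - r) mod N" y]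
    by (force simp: add.commute)
  then show ?thesis
    by (simp add: rotate_to_one_based_def rotate_to_zero_based_def map_idI)
qed

text \<open>Entries at most \<open>i\<close> after rotation come from the cyclic window of residues
  \<open>r, ..., r + i - 1\<close>. Since \<open>i \<le> N\<close>, no residue occurs twice in the
  window.\<close>

lemma length_filter_rotate_to_one_based:
  assumes "set f \<subseteq> {..<N}" "r < N" "i \<le> N"
  shows "length (filter (\<lambda>x. x \<le> i) (rotate_to_one_based N r f)) =
         (\<Sum>t<i. count_list f ((r + t) mod N))"
  using assms(1)
proof (induction f)
  case Nil
  then show ?case by (simp add: rotate_to_one_based_def)
next
  case (Cons y f)
  have "(\<Sum>t<i. if y = (r + t) mod N then 1 else 0 :: nat) =
        (\<Sum>t<i. if t = (y + N - r) mod N then 1 else 0)"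
    using Cons.prems assms by (intro sum.cong refl) (simp add: add_mod_eq_iff)
  also have "\<dots> = (if (y + N - r) mod N < i then 1 else 0)"
    by simp
  finally have *: "(\<Sum>t<i. if y = (r + t) mod N then 1 else 0 :: nat) = \<dots>" .
  have "(\<Sum>t<i. count_list (y # f) ((r + t) mod N)) =
        (\<Sum>t<i. (if y = (r + t) mod N then 1 else 0) + count_list f ((r + t) mod N))"
    by (intro sum.cong) auto
  also have "\<dots> = (if (y + N - r) mod N < i then 1 else 0) +
                  (\<Sum>t<i. count_list f ((r + t) mod N))"
    by (simp only: sum.distrib *)
  finally show ?case
    using Cons by (auto simp: rotate_to_one_based_def)
qed

text \<open>There are \<open>n\<close> entries but only \<open>n - 1\<close> residues, so the
  excesses add up to 1 over a period, as \<open>cycle_lemma\<close> demands.\<close>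

lemma unique_prime_rotation:
  assumes "2 \<le> n" "length f = n" "set f \<subseteq> {..<n - 1}"
  shows "\<exists>!r. r < n - 1 \<and> rotate_to_one_based (n - 1) r f \<in> PPF n"
proof -
  define N where "N = n - 1"
  have N: "0 < N" "n = Suc N" using assms by (auto simp: N_def)
  \<comment> \<open>The rotation by \<open>r\<close> is prime iff the partial sums starting at \<open>r\<close> of the
    excesses (multiplicity minus one) are positive.\<close>
  define S where "S = (\<lambda>j. \<Sum>t<j. int (count_list f (t mod N)) - 1)"
  have per: "S (j + N) = S j + 1" for j
  proof (induction j)
    case 0
    have "S N = int (\<Sum>t<N. count_list f t) - int N"
      by (simp add: S_def sum_subtractf)
    also have "(\<Sum>t<N. count_list f t) = length f"
      using assms by (intro sum_count_set) (auto simp: N_def)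
    finally show ?case using assms N by (simp add: S_def)
  next
    case (Suc j)
    then show ?case by (simp add: S_def)
  qed
  have diff: "S (r + i) = S r + int (\<Sum>t<i. count_list f ((r + t) mod N)) - int i" for r i
    by (induction i) (simp_all add: S_def)
  have "rotate_to_one_based N r f \<in> PPF n \<longleftrightarrow> (\<forall>i\<in>{1..N}. S r < S (r + i))" if "r < N" for r
  proof -
    have "length (filter (\<lambda>x. x \<le> i) (rotate_to_one_based N r f)) =
         (\<Sum>t<i. count_list f ((r + t) mod N))" if "i \<in> {1..N}" for i
      using that \<open>r < N\<close> assms by (intro length_filter_rotate_to_one_based) (auto simp: N_def)
    then have "rotate_to_one_based N r f \<in> PPF n \<longleftrightarrow>
        (\<forall>i\<in>{1..N}. i < (\<Sum>t<i. count_list f ((r + t) mod N)))"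
      using assms by (auto simp: PPF_iff N_def rotate_to_one_based_def)
    also have "\<dots> \<longleftrightarrow> (\<forall>i\<in>{1..N}. S r < S (r + i))"
      unfolding diff by (intro ball_cong refl) linarith
    finally show ?thesis .
  qed
  then show ?thesis
    using cycle_lemma[of S N, OF per N(1)] unfolding N_def[symmetric] by metis
qed

section \<open>Counting sequences without prescribed ties\<close>

text \<open>Build the list from left to right: the first entry is free, and a later one has to avoid
  its predecessor exactly when its position is in \<open>E\<close>.\<close>

lemma card_lists_no_ties:
  fixes E :: "nat set"
  assumes "0 < N"
  shows "card {f. length f = Suc l \<and> set f \<subseteq> {..<N} \<and> (\<forall>i\<in>E \<inter> {1..l}. f ! (i - 1) \<noteq> f ! i)} =
         N * (\<Prod>i=1..l. if i \<in> E then N - 1 else N)"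
proof (induction l)
  case 0
  have "{f. length f = Suc 0 \<and> set f \<subseteq> {..<N}} = (\<lambda>x. [x]) ` {..<N}"
    by (auto simp: length_Suc_conv)
  then show ?case by (simp add: card_image inj_on_def)
next
  case (Suc l)
  let ?A = "\<lambda>l. {f. length f = Suc l \<and> set f \<subseteq> {..<N} \<and> (\<forall>i\<in>E \<inter> {1..l}. f ! (i - 1) \<noteq> f ! i)}"
  let ?X = "\<lambda>g. if Suc l \<in> E then {..<N} - {last g} else {..<N}"
  have fin: "finite (?A l)"
    by (rule finite_subset[OF _ finite_lists_length_eq[of "{..<N}" "Suc l"]]) auto
  have nth_app: "(\<forall>i\<in>E \<inter> {1..Suc l}. (g @ [x]) ! (i - 1) \<noteq> (g @ [x]) ! i) \<longleftrightarrow>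
      (\<forall>i\<in>E \<inter> {1..l}. g ! (i - 1) \<noteq> g ! i) \<and> (Suc l \<in> E \<longrightarrow> last g \<noteq> x)"
    if "length g = Suc l" for g :: "nat list" and x
  proof -
    have "E \<inter> {1..Suc l} = (if Suc l \<in> E then insert (Suc l) (E \<inter> {1..l}) else E \<inter> {1..l})"
      by (auto simp: le_Suc_eq)
    moreover have "last g = g ! l"
      using that by (metis diff_Suc_1 last_conv_nth list.size(3) nat.distinct(1))
    ultimately show ?thesis using that by (auto simp: nth_append)
  qed
  \<comment> \<open>Splitting off the last entry gives a dependent product whose fibres all have the
    same size.\<close>
  have "?A (Suc l) = (\<lambda>(g, x). g @ [x]) ` (SIGMA g:?A l. ?X g)"
  proof (intro equalityI subsetI)
    fix f assume f: "f \<in> ?A (Suc l)"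
    then have "f \<noteq> []" by auto
    then obtain g x where fg: "f = g @ [x]" by (metis append_butlast_last_id)
    with f have "length g = Suc l" by simp
    with f fg nth_app[of g x] have "g \<in> ?A l" "x \<in> ?X g"
      by auto
    with fg show "f \<in> (\<lambda>(g, x). g @ [x]) ` (SIGMA g:?A l. ?X g)"
      by (force intro!: image_eqI[of _ _ "(g, x)"])
  next
    fix f assume "f \<in> (\<lambda>(g, x). g @ [x]) ` (SIGMA g:?A l. ?X g)"
    then obtain g x where fg: "f = g @ [x]" "g \<in> ?A l" "x \<in> ?X g" by auto
    with nth_app[of g x] show "f \<in> ?A (Suc l)"
      by (auto split: if_splits)
  qed
  moreover have "inj_on (\<lambda>(g, x). g @ [x]) (SIGMA g:?A l. ?X g)"
    by (auto simp: inj_on_def)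
  ultimately have "card (?A (Suc l)) = card (SIGMA g:?A l. ?X g)"
    by (simp add: card_image)
  also have "\<dots> = (\<Sum>g\<in>?A l. card (?X g))"
    using fin by (intro card_SigmaI) auto
  also have "\<dots> = (\<Sum>g\<in>?A l. if Suc l \<in> E then N - 1 else N)"
  proof (intro sum.cong refl)
    fix g assume "g \<in> ?A l"
    then have "g \<noteq> []" "set g \<subseteq> {..<N}" by auto
    then have "last g \<in> {..<N}" by (meson last_in_set subsetD)
    then show "card (?X g) = (if Suc l \<in> E then N - 1 else N)" by simp
  qed
  also have "\<dots> = card (?A l) * (if Suc l \<in> E then N - 1 else N)"
    by simp
  finally show ?case using Suc.IH by (simp add: mult_ac)
qed

lemma card_PPF_no_ties:
  fixes E :: "nat set"
  assumes n: "2 \<le> n" and E: "E \<subseteq> {1..<n}"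
  shows "card {\<pi> \<in> PPF n. \<forall>i\<in>E. \<pi> ! (i - 1) \<noteq> \<pi> ! i} =
         (n - 2) ^ card E * (n - 1) ^ (n - 1 - card E)"
proof -
  define N where "N = n - 1"
  have N: "0 < N" "n = Suc N" using n by (auto simp: N_def)
  let ?P = "{\<pi> \<in> PPF n. \<forall>i\<in>E. \<pi> ! (i - 1) \<noteq> \<pi> ! i}"
  define A where "A = {f. length f = Suc N \<and> set f \<subseteq> {..<N} \<and> (\<forall>i\<in>E \<inter> {1..N}. f ! (i - 1) \<noteq> f ! i)}"
  \<comment> \<open>\<open>R f\<close> is the rotation that makes \<open>f\<close> prime;
    \<open>ex1\<close> makes the description well defined.\<close>
  define R where "R = (\<lambda>f. THE r. r < N \<and> rotate_to_one_based N r f \<in> PPF n)"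
  have ex1: "\<exists>!r. r < N \<and> rotate_to_one_based N r f \<in> PPF n" if "f \<in> A" for f
    using that n unfolding N_def by (intro unique_prime_rotation) (auto simp: A_def N_def)
  have R: "R f < N" "rotate_to_one_based N (R f) f \<in> PPF n" if "f \<in> A" for f
    using theI'[OF ex1[OF that]] by (auto simp: R_def)
  have R_eq: "R f = r" if "f \<in> A" "r < N" "rotate_to_one_based N r f \<in> PPF n" for f r
    using ex1[OF that(1)] R[OF that(1)] that by blast
  have E_less: "i < n" if "i \<in> E" for i
    using E that by auto
  have EN: "E \<inter> {1..N} = E" using E N by auto
  have PPF: "length \<pi> = n" "set \<pi> \<subseteq> {1..N}" if "\<pi> \<in> PPF n" for \<pi>
    using that PPF_set_subset[OF n that] by (auto simp: PPF_def N_def)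
  \<comment> \<open>Subtracting \<open>r\<close> modulo \<open>N\<close> is injective on residues,
    so rotation creates no tie.\<close>
  have one_tie: "rotate_to_one_based N r f ! (i - 1) \<noteq> rotate_to_one_based N r f ! i"
    if "f \<in> A" "r < N" "i \<in> E" for f r i
  proof -
    have i: "i < length f" "i - 1 < length f" "f ! (i - 1) \<noteq> f ! i"
      using that E_less[OF that(3)] EN N by (auto simp: A_def)
    then have "f ! i < N" "f ! (i - 1) < N"
      using that(1) nth_mem[OF i(1)] nth_mem[OF i(2)] unfolding A_def by blast+
    then have "(f ! (i - 1) + N - r) mod N \<noteq> (f ! i + N - r) mod N"
      using i(3) that(2) add_mod_eq_iff[of r N _ "f ! i"] add_mod_eq_iff[of r N _ "f ! (i - 1)"]
      by (metis mod_less_divisor N(1))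
    then show ?thesis using i by (simp add: rotate_to_one_based_def)
  qed
  have zero_in: "rotate_to_zero_based N r \<pi> \<in> A" if "\<pi> \<in> ?P" "r < N" for \<pi> r
  proof -
    have P: "length \<pi> = n" "set \<pi> \<subseteq> {1..N}" using PPF that by auto
    have "rotate_to_zero_based N r \<pi> ! (i - 1) \<noteq> rotate_to_zero_based N r \<pi> ! i" if i: "i \<in> E" for i
    proof
      have l: "i < length \<pi>" "i - 1 < length \<pi>" using P E_less[OF i] by auto
      assume "rotate_to_zero_based N r \<pi> ! (i - 1) = rotate_to_zero_based N r \<pi> ! i"
      then have "rotate_to_one_based N r (rotate_to_zero_based N r \<pi>) ! (i - 1) =
            rotate_to_one_based N r (rotate_to_zero_based N r \<pi>) ! i"
        using l by (simp add: rotate_to_one_based_def rotate_to_zero_based_def)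
      then show False
        using rotate_to_zero_to_one_based[OF P(2) \<open>r < N\<close>] \<open>\<pi> \<in> ?P\<close> i by simp
    qed
    then show ?thesis
      using P N EN by (auto simp: A_def) (auto simp: rotate_to_zero_based_def)
  qed
  \<comment> \<open>A sequence is recorded by its prime translate and the amount of rotation.
    Undoing the rotation is the inverse; uniqueness of \<open>R\<close> recovers the second
    component.\<close>
  have "bij_betw (\<lambda>f. (rotate_to_one_based N (R f) f, R f)) A (?P \<times> {..<N})"
  proof (rule bij_betw_byWitness[where f' = "\<lambda>(\<pi>, r). rotate_to_zero_based N r \<pi>"])
    show "\<forall>f\<in>A. (\<lambda>(\<pi>, r). rotate_to_zero_based N r \<pi>) (rotate_to_one_based N (R f) f, R f) = f"
      using R by (auto simp: A_def intro!: rotate_to_one_to_zero_based)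
    have "R (rotate_to_zero_based N r \<pi>) = r"
      and "rotate_to_one_based N r (rotate_to_zero_based N r \<pi>) = \<pi>"
      if "\<pi> \<in> ?P" "r < N" for \<pi> r
    proof -
      show *: "rotate_to_one_based N r (rotate_to_zero_based N r \<pi>) = \<pi>"
        using that PPF by (intro rotate_to_zero_to_one_based) auto
      show "R (rotate_to_zero_based N r \<pi>) = r"
        by (rule R_eq[OF zero_in]) (use that * in auto)
    qed
    then show "\<forall>a\<in>?P \<times> {..<N}.
       (\<lambda>f. (rotate_to_one_based N (R f) f, R f)) ((\<lambda>(\<pi>, r). rotate_to_zero_based N r \<pi>) a) = a"
      by auto
    show "(\<lambda>f. (rotate_to_one_based N (R f) f, R f)) ` A \<subseteq> ?P \<times> {..<N}"
      using R one_tie by auto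
    show "(\<lambda>(\<pi>, r). rotate_to_zero_based N r \<pi>) ` (?P \<times> {..<N}) \<subseteq> A"
      using zero_in by auto
  qed
  then have "card A = N * card ?P"
    by (simp add: bij_betw_same_card card_cartesian_product)
  moreover have "card A = N * (\<Prod>i=1..N. if i \<in> E then N - 1 else N)"
    unfolding A_def using card_lists_no_ties[OF N(1)] .
  ultimately have "card ?P = (\<Prod>i=1..N. if i \<in> E then N - 1 else N)"
    using N by simp
  also have "\<dots> = (N - 1) ^ card E * N ^ card ({1..N} - E)"
    using EN by (simp add: prod.If_cases Int_commute Diff_eq)
  also have "card ({1..N} - E) = N - card E"
    using EN by (subst card_Diff_subset) (auto intro: finite_subset)
  finally show ?thesis
    by (simp add: N_def numeral_2_eq_2)
qed

lemma PPF_1: "PPF 1 = {[1]}"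
proof -
  have "length \<pi> = 1 \<longleftrightarrow> (\<exists>a. \<pi> = [a])" for \<pi> :: "nat list"
    by (auto simp: length_Suc_conv)
  then show ?thesis
    by (auto simp: PPF_def prime_parking_function_def parking_function_def)
qed

text \<open>Integer bases avoid the truncated \<open>n - 2\<close> at \<open>n = 1\<close>. There
  \<open>E\<close> is empty and both exponents are 0, giving the single element
  \<open>[1]\<close>.\<close>

lemma card_PPF_no_ties_int:
  fixes E :: "nat set"
  assumes "1 \<le> n" and E: "E \<subseteq> {1..<n}"
  shows "int (card {\<pi> \<in> PPF n. \<forall>i\<in>E. \<pi> ! (i - 1) \<noteq> \<pi> ! i}) =
         (int n - 2) ^ card E * (int n - 1) ^ (n - 1 - card E)"
proof (cases "n = 1")
  case True
  with E have "E = {}" by auto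
  with True show ?thesis using PPF_1 by simp
next
  case False
  with assms have "2 \<le> n" by simp
  then show ?thesis
    using card_PPF_no_ties[OF _ E] by (simp add: of_nat_diff)
qed

section \<open>Coefficients of the quasisymmetric side\<close>

lemma pser_coeff_sum: "pser_coeff (\<Sum>a\<in>A. f a) m = (\<Sum>a\<in>A. pser_coeff (f a) m)"
  by (induction A rule: infinite_finite_induct) (simp_all add: zero_pser.rep_eq plus_pser.rep_eq)

text \<open>A weakly increasing index sequence is determined by its multiset, so each fibre has at
  most one element.\<close>

lemma pser_coeff_fundamental_qsym:
  assumes "size m = n" "0 \<notin># m"
  shows "pser_coeff (fundamental_qsym n S) m =
    (if \<forall>i\<in>{1..<n}. i \<in> S \<longrightarrow>
          sorted_list_of_multiset m ! (i - 1) < sorted_list_of_multiset m ! i then 1 else 0)"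
proof -
  let ?b = "sorted_list_of_multiset m"
  have "length ?b = n"
    using assms by (metis mset_sorted_list_of_multiset size_mset)
  moreover have "\<forall>a\<in>set ?b. 1 \<le> a"
    using assms by (auto simp: Suc_le_eq intro!: gr0I)
  ultimately have b_iff: "?b \<in> fundamental_seqs n S \<longleftrightarrow>
      (\<forall>i\<in>{1..<n}. i \<in> S \<longrightarrow> ?b ! (i - 1) < ?b ! i)"
    by (simp add: fundamental_seqs_def)
  have "t = ?b" if "t \<in> fundamental_seqs n S" "mset t = m" for t
  proof -
    have "sorted t" using that(1) by (simp add: fundamental_seqs_def)
    then show ?thesis
      using that(2) by (metis sorted_list_of_multiset_mset sorted_sort_id)
  qed
  then have "{t \<in> fundamental_seqs n S. mset t = m} = {t. t = ?b \<and> ?b \<in> fundamental_seqs n S}"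
    using mset_sorted_list_of_multiset[of m] by (intro Collect_cong) metis
  then show ?thesis
    unfolding b_iff by (simp add: fundamental_qsym_def monomial_sum.rep_eq)
qed

text \<open>Each distinct value of a sorted list begins exactly one block, and every entry that does
  not begin a block ties with its predecessor.\<close>

lemma card_ties_sorted:
  fixes b :: "'a::linorder list"
  assumes "sorted b"
  shows "card {i \<in> {1..<length b}. b ! (i - 1) = b ! i} + card (set b) = length b"
  using assms
proof (induction b rule: rev_induct)
  case (snoc x b)
  let ?T = "\<lambda>b :: 'a list. {i \<in> {1..<length b}. b ! (i - 1) = b ! i}"
  show ?case
  proof (cases "b = []")
    case False
    have IH: "card (?T b) + card (set b) = length b"
      using snoc by (simp add: sorted_append)
    have last: "last b = b ! (length b - 1)"
      using False by (rule last_conv_nth)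
    have x: "x \<in> set b \<longleftrightarrow> last b = x"
    proof
      assume "x \<in> set b"
      then obtain p where "p < length b" "b ! p = x" by (auto simp: in_set_conv_nth)
      moreover from this have "b ! p \<le> b ! (length b - 1)"
        using snoc.prems by (intro sorted_nth_mono) (auto simp: sorted_append)
      moreover have "last b \<le> x"
        using snoc.prems False by (simp add: sorted_append)
      ultimately show "last b = x" using last by simp
    qed (use False in auto)
    have "?T (b @ [x]) = (if last b = x then insert (length b) (?T b) else ?T b)"
      using False by (auto simp: nth_append last less_Suc_eq Suc_le_eq)
    moreover have "length b \<notin> ?T b" by simp
    ultimately show ?thesis
      using IH x by (auto simp: insert_absorb)
  qed simp
qed simp

lemma coeff_sum_fundamental_qsym:
  assumes "1 \<le> n" "size m = n" "0 \<notin># m"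
  shows "pser_coeff (\<Sum>\<pi>\<in>PPF n. fundamental_qsym n (Tie \<pi>)) m =
         (int n - 2) ^ (n - card (set_mset m)) * (int n - 1) ^ (card (set_mset m) - 1)"
proof -
  let ?b = "sorted_list_of_multiset m"
  define E where "E = {i \<in> {1..<n}. ?b ! (i - 1) = ?b ! i}"
  have len: "length ?b = n"
    using assms by (metis mset_sorted_list_of_multiset size_mset)
  have cardE: "card E + card (set_mset m) = n"
    using card_ties_sorted[of ?b] len by (simp add: E_def)
  have pos: "card (set_mset m) > 0"
    using assms by (auto simp: card_gt_0_iff)
  have mono: "?b ! (i - 1) < ?b ! i \<longleftrightarrow> ?b ! (i - 1) \<noteq> ?b ! i" if "i \<in> {1..<n}" for i
    using sorted_nth_mono[of ?b "i - 1" i] that len by auto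
  \<comment> \<open>Both sides say that \<open>Tie \<pi>\<close> is disjoint from \<open>E\<close>,
    the ties of the sorted word of \<open>m\<close>.\<close>
  have no_ties: "(\<forall>i\<in>{1..<n}. i \<in> Tie \<pi> \<longrightarrow> ?b ! (i - 1) < ?b ! i) \<longleftrightarrow>
        (\<forall>i\<in>E. \<pi> ! (i - 1) \<noteq> \<pi> ! i)" if "\<pi> \<in> PPF n" for \<pi>
    using that mono by (auto simp: Tie_def E_def PPF_def)
  have "pser_coeff (\<Sum>\<pi>\<in>PPF n. fundamental_qsym n (Tie \<pi>)) m =
        (\<Sum>\<pi>\<in>PPF n. if \<forall>i\<in>E. \<pi> ! (i - 1) \<noteq> \<pi> ! i then 1 else 0)"
    unfolding pser_coeff_sum pser_coeff_fundamental_qsym[OF assms(2,3)]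
    by (intro sum.cong refl) (simp only: no_ties)
  also have "\<dots> = int (card {\<pi> \<in> PPF n. \<forall>i\<in>E. \<pi> ! (i - 1) \<noteq> \<pi> ! i})"
    by (simp add: finite_PPF sum.If_cases Int_def)
  also have "\<dots> = (int n - 2) ^ card E * (int n - 1) ^ (n - 1 - card E)"
    using assms by (intro card_PPF_no_ties_int) (auto simp: E_def)
  also have "\<dots> = (int n - 2) ^ (n - card (set_mset m)) * (int n - 1) ^ (card (set_mset m) - 1)"
  proof -
    have "card E = n - card (set_mset m)" "n - 1 - card E = card (set_mset m) - 1"
      using cardE pos by auto
    then show ?thesis by simp
  qed
  finally show ?thesis .
qed

section \<open>Coefficients of hook Schur functions\<close>

text \<open>A hook tableau is a first row and the column below its corner. As
  \<open>i \<ge> 1\<close>, the row is nonempty and \<open>hd row\<close> is the corner that the two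
  conditions share.\<close>

lemma ssyt_hook_iff:
  assumes "1 \<le> i"
  shows "T \<in> ssyt (hook n i) \<longleftrightarrow>
    (\<exists>row col. T = row # map (\<lambda>x. [x]) col \<and> length row = i \<and> length col = n - i \<and>
       sorted row \<and> (\<forall>a\<in>set row \<union> set col. 1 \<le> a) \<and> sorted_wrt (<) (hd row # col))"
proof -
  have shape: "map length T = hook n i \<longleftrightarrow>
      (\<exists>row col. T = row # map (\<lambda>x. [x]) col \<and> length row = i \<and> length col = n - i)"
  proof
    assume L: "map length T = hook n i"
    then obtain row T' where T: "T = row # T'" "length row = i" "map length T' = replicate (n - i) 1"
      by (auto simp: hook_def)
    then have "length r = 1" if "r \<in> set T'" for r
      using that by (metis image_eqI in_set_replicate list.set_map)
    then have "[hd r] = r" if "r \<in> set T'" for r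
      using that by (metis length_0_conv length_Suc_conv list.sel(1) One_nat_def)
    then have "map (\<lambda>x. [x]) (map hd T') = T'"
      by (simp add: map_idI)
    moreover have "length (map hd T') = n - i"
      using T(3) by (metis length_map length_replicate)
    ultimately show "\<exists>row col. T = row # map (\<lambda>x. [x]) col \<and> length row = i \<and> length col = n - i"
      using T by metis
  qed (auto simp: hook_def intro!: replicate_eqI)
  have tableau: "row # map (\<lambda>x. [x]) col \<in> ssyt (hook n i) \<longleftrightarrow>
      sorted row \<and> (\<forall>a\<in>set row \<union> set col. 1 \<le> a) \<and> sorted_wrt (<) (hd row # col)"
    if rc: "length row = i" "length col = n - i" for row col
  proof -
    let ?T = "row # map (\<lambda>x. [x]) col"
    have "row \<noteq> []" using rc assms by auto
    then have entry: "?T ! p ! 0 = (hd row # col) ! p" if "p < length ?T" for p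
      using that by (cases p) (auto simp: hd_conv_nth)
    \<comment> \<open>Rows below the first have length 1, so only column \<open>j = 0\<close>
      imposes conditions.\<close>
    have "(\<forall>p j. Suc p < length ?T \<longrightarrow> j < length (?T ! Suc p) \<longrightarrow> ?T ! p ! j < ?T ! Suc p ! j) \<longleftrightarrow>
          (\<forall>p. Suc p < length ?T \<longrightarrow> ?T ! p ! 0 < ?T ! Suc p ! 0)"
      by auto
    also have "\<dots> \<longleftrightarrow> (\<forall>p. Suc p < length (hd row # col) \<longrightarrow>
                          (hd row # col) ! p < (hd row # col) ! Suc p)"
      using entry by (metis Suc_lessD length_Cons length_map)
    also have "\<dots> \<longleftrightarrow> sorted_wrt (<) (hd row # col)"
      by (rule sorted_wrt_iff_nth_Suc_transp[symmetric]) simp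
    finally have column: "(\<forall>p j. Suc p < length ?T \<longrightarrow> j < length (?T ! Suc p) \<longrightarrow>
        ?T ! p ! j < ?T ! Suc p ! j) \<longleftrightarrow> sorted_wrt (<) (hd row # col)" .
    have "map length ?T = hook n i"
      using rc by (auto simp: hook_def intro!: replicate_eqI)
    then show ?thesis
      unfolding ssyt_def mem_Collect_eq column by auto
  qed
  have "map length T = hook n i" if "T \<in> ssyt (hook n i)"
    using that by (simp add: ssyt_def)
  then show ?thesis
    using tableau shape by metis
qed

lemma mset_concat_map_singleton: "mset (concat (row # map (\<lambda>x. [x]) col)) = mset row + mset col"
  by simp

text \<open>The corner must be the minimum \<open>a\<close>. The strict column below it is a set
  \<open>C\<close> avoiding \<open>a\<close>, and sorting the remaining content recovers the
  row.\<close>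

lemma card_ssyt_hook:
  assumes n: "size m = n" and i: "1 \<le> i" "i \<le> n" and m: "0 \<notin># m"
  shows "card {T \<in> ssyt (hook n i). mset (concat T) = m} =
         (card (set_mset m) - 1) choose (n - i)"
proof -
  define a where "a = Min (set_mset m)"
  have ne: "set_mset m \<noteq> {}" using n i by auto
  have a: "a \<in># m" and a_le: "\<And>x. x \<in># m \<Longrightarrow> a \<le> x"
    using Min_in[OF _ ne] by (auto simp: a_def)
  let ?Cs = "{C. C \<subseteq> set_mset m - {a} \<and> card C = n - i}"
  let ?Ts = "{T \<in> ssyt (hook n i). mset (concat T) = m}"
  define \<Phi> where "\<Phi> = (\<lambda>C. sorted_list_of_multiset (m - mset_set C) #
                              map (\<lambda>x. [x]) (sorted_list_of_set C))"
  have "bij_betw \<Phi> ?Cs ?Ts"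
  proof (rule bij_betwI')
    have inverse: "set (concat (tl (\<Phi> C))) = C" if "C \<in> ?Cs" for C
      using that finite_subset[of C "set_mset m - {a}"] by (auto simp: \<Phi>_def)
    fix C D assume "C \<in> ?Cs" "D \<in> ?Cs"
    then show "\<Phi> C = \<Phi> D \<longleftrightarrow> C = D"
      using inverse by metis
  next
    fix C assume C: "C \<in> ?Cs"
    then have fin: "finite C" using finite_subset[of C "set_mset m - {a}"] by auto
    have sub: "mset_set C \<subseteq># m"
      using C fin by (intro mset_subset_eqI) (auto simp: count_mset_set' Suc_le_eq)
    let ?row = "sorted_list_of_multiset (m - mset_set C)"
    have set_row: "set ?row \<subseteq> set_mset m"
      by (auto dest: in_diffD)
    \<comment> \<open>As \<open>a\<close> is not in \<open>C\<close>, it survives in the row and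
      therefore leads it.\<close>
    have "a \<in># m - mset_set C"
      using a C fin by (auto simp: in_diff_count count_mset_set')
    then have a_row: "a \<in> set ?row" by simp
    then have "hd ?row \<in> set ?row" by (metis hd_in_set list.set_cases list.distinct(1))
    moreover have "hd ?row \<le> a"
      using a_row sorted_sorted_list_of_multiset[of "m - mset_set C"] by (cases ?row) auto
    ultimately have hd: "hd ?row = a"
      using a_le set_row by (meson antisym subsetD)
    have "length ?row = i"
    proof -
      have "length ?row = size (m - mset_set C)"
        by (metis mset_sorted_list_of_multiset size_mset)
      then show ?thesis using C n i sub by (simp add: size_Diff_submset)
    qed
    moreover have "sorted_wrt (<) (a # sorted_list_of_set C)"
      using C fin a_le by (auto simp: order_less_le)
    moreover have "\<forall>x\<in>set ?row \<union> set (sorted_list_of_set C). 1 \<le> x"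
      using set_row C fin m by (auto simp: Suc_le_eq intro!: gr0I)
    ultimately have "\<Phi> C \<in> ssyt (hook n i)"
      using C hd unfolding ssyt_hook_iff[OF i(1)] \<Phi>_def
      by (intro exI[of _ ?row] exI[of _ "sorted_list_of_set C"]) simp
    moreover have "mset (concat (\<Phi> C)) = m"
      using sub fin mset_set_set[of "sorted_list_of_set C"]
      unfolding \<Phi>_def mset_concat_map_singleton by simp
    ultimately show "\<Phi> C \<in> ?Ts" by simp
  next
    fix T assume T: "T \<in> ?Ts"
    then obtain row col where rc: "T = row # map (\<lambda>x. [x]) col" "length row = i"
      "length col = n - i" "sorted row" "sorted_wrt (<) (hd row # col)"
      using ssyt_hook_iff[OF i(1)] by auto
    have ms: "m = mset row + mset col"
      using T rc(1) mset_concat_map_singleton by auto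
    have dist: "distinct col" "sorted col"
      using rc(5) by (auto simp: strict_sorted_iff)
    have "row \<noteq> []" using rc i by auto
    then have "hd row \<in> set row" "\<forall>x\<in>set row. hd row \<le> x"
      using rc(4) by (cases row; auto)+
    \<comment> \<open>The corner is minimal in the row by sortedness and in the column by
      strictness.\<close>
    with rc(5) have "a = hd row"
      unfolding a_def ms by (intro Min_eqI) (auto simp: less_imp_le)
    with rc(5) ms have "set col \<subseteq> set_mset m - {a}" by auto
    then have "set col \<in> ?Cs"
      using rc(3) dist by (simp add: distinct_card)
    moreover have "T = \<Phi> (set col)"
      using rc dist ms by (simp add: \<Phi>_def mset_set_set sorted_list_of_set.idem_if_sorted_distinct
          sorted_sort_id)
    ultimately show "\<exists>C\<in>?Cs. T = \<Phi> C" by blast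
  qed
  then have "card ?Ts = card ?Cs"
    by (simp add: bij_betw_same_card)
  also have "\<dots> = (card (set_mset m) - 1) choose (n - i)"
    using a by (simp add: n_subsets)
  finally show ?thesis .
qed

section \<open>The binomial identity and the comparison of coefficients\<close>

text \<open>Substituting \<open>j = n - i\<close> and taking out \<open>x ^ (n - k)\<close> leaves
  the binomial expansion of \<open>(1 + x) ^ (k - 1)\<close>.\<close>

lemma sum_power_times_choose:
  fixes x :: "'a::comm_ring_1"
  assumes "1 \<le> k" "k \<le> n"
  shows "(\<Sum>i=1..n. x ^ (i - 1) * of_nat ((k - 1) choose (n - i))) = x ^ (n - k) * (x + 1) ^ (k - 1)"
proof -
  have "(\<Sum>i=1..n. x ^ (i - 1) * of_nat ((k - 1) choose (n - i))) =
        (\<Sum>j<n. x ^ (n - 1 - j) * of_nat ((k - 1) choose j))"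
    by (rule sum.reindex_bij_witness[of _ "\<lambda>j. n - j" "\<lambda>i. n - i"]) auto
  \<comment> \<open>Terms with \<open>j > k - 1\<close> have a vanishing binomial coefficient;
    \<open>k \<le> n\<close> keeps the new range inside the old one.\<close>
  also have "\<dots> = (\<Sum>j\<le>k - 1. x ^ (n - 1 - j) * of_nat ((k - 1) choose j))"
    using assms by (intro sum.mono_neutral_right) (auto simp: not_le binomial_eq_0)
  also have "\<dots> = (\<Sum>j\<le>k - 1. x ^ (n - k) * (of_nat ((k - 1) choose j) * 1 ^ j * x ^ (k - 1 - j)))"
  proof (intro sum.cong refl)
    fix j assume "j \<in> {..k - 1}"
    then have "n - 1 - j = (n - k) + (k - 1 - j)" using assms by auto
    then show "x ^ (n - 1 - j) * of_nat ((k - 1) choose j) =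
        x ^ (n - k) * (of_nat ((k - 1) choose j) * 1 ^ j * x ^ (k - 1 - j))"
      by (simp add: power_add mult_ac)
  qed
  also have "\<dots> = x ^ (n - k) * (1 + x) ^ (k - 1)"
    unfolding binomial_ring by (simp add: sum_distrib_left)
  finally show ?thesis by (simp add: add.commute)
qed

text \<open>Variables are indexed from 1, so a multiset containing 0 is never the monomial of an
  index sequence.\<close>

lemma pser_coeff_fundamental_qsym_eq_0:
  assumes "size m \<noteq> n \<or> 0 \<in># m"
  shows "pser_coeff (fundamental_qsym n S) m = 0"
proof -
  have "{t \<in> fundamental_seqs n S. mset t = m} = {}"
    using assms by (force simp: fundamental_seqs_def)
  then show ?thesis
    by (simp only: fundamental_qsym_def monomial_sum.rep_eq card.empty of_nat_0)
qed

lemma pser_coeff_schur_hook_eq_0: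
  assumes "size m \<noteq> n \<or> 0 \<in># m" "1 \<le> i" "i \<le> n"
  shows "pser_coeff (schur (hook n i)) m = 0"
proof -
  have "size m = n \<and> 0 \<notin># m" if T: "T \<in> ssyt (hook n i)" "mset (concat T) = m" for T
  proof -
    obtain row col where "T = row # map (\<lambda>x. [x]) col" "length row = i" "length col = n - i"
      "\<forall>a\<in>set row \<union> set col. 1 \<le> a"
      using T(1) unfolding ssyt_hook_iff[OF assms(2)] by blast
    with T assms mset_concat_map_singleton[of row col] show ?thesis by force
  qed
  then have "{T \<in> ssyt (hook n i). mset (concat T) = m} = {}"
    using assms by blast
  then show ?thesis
    by (simp only: schur_def monomial_sum.rep_eq card.empty of_nat_0)
qed

theorem theorem6p2:
  fixes n :: nat
  assumes "n \<ge> 1"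
  shows "(\<Sum>\<pi>\<in>PPF n. fundamental_qsym n (Tie \<pi>)) =
         (\<Sum>i=1..n. (int n - 2) ^ (i - 1) \<cdot>\<^sub>p schur (hook n i))"
  unfolding pser_eq_iff
proof
  fix m :: "nat multiset"
  let ?k = "card (set_mset m)"
  have rhs: "pser_coeff (\<Sum>i=1..n. (int n - 2) ^ (i - 1) \<cdot>\<^sub>p schur (hook n i)) m =
      (\<Sum>i=1..n. (int n - 2) ^ (i - 1) * pser_coeff (schur (hook n i)) m)"
    by (simp add: pser_coeff_sum pser_smult.rep_eq)
  show "pser_coeff (\<Sum>\<pi>\<in>PPF n. fundamental_qsym n (Tie \<pi>)) m =
        pser_coeff (\<Sum>i=1..n. (int n - 2) ^ (i - 1) \<cdot>\<^sub>p schur (hook n i)) m"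
  proof (cases "size m = n \<and> 0 \<notin># m")
    case True
    then have "m \<noteq> {#}" using assms by auto
    then have "1 \<le> ?k"
      by (simp add: Suc_le_eq card_gt_0_iff)
    moreover have "?k \<le> n"
      using True by (metis card_length ex_mset set_mset_mset size_mset)
    ultimately have k: "1 \<le> ?k" "?k \<le> n" .
    have "(\<Sum>i=1..n. (int n - 2) ^ (i - 1) * pser_coeff (schur (hook n i)) m) =
          (\<Sum>i=1..n. (int n - 2) ^ (i - 1) * of_nat ((?k - 1) choose (n - i)))"
      using True by (intro sum.cong refl)
        (simp add: schur_def monomial_sum.rep_eq card_ssyt_hook)
    \<comment> \<open>With \<open>x = n - 2\<close>, the factor \<open>x + 1\<close> is the
      \<open>n - 1\<close> of the parking function count.\<close>
    also have "\<dots> = (int n - 2) ^ (n - ?k) * (int n - 1) ^ (?k - 1)"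
      using sum_power_times_choose[OF k, of "int n - 2"] by simp
    finally show ?thesis
      using coeff_sum_fundamental_qsym[OF assms] True rhs by simp
  next
    case False
    then show ?thesis
      unfolding pser_coeff_sum pser_smult.rep_eq
      by (simp add: pser_coeff_fundamental_qsym_eq_0 pser_coeff_schur_hook_eq_0)
  qed
qed

end
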